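(* Let $f:\mathbb{Z}^n\to\mathbb{Z}\cup\{+\infty\}$ be an integer-valued integrally convex function with $\operatorname{dom} f\neq\emptyset$, and let $\Psi:\mathbb{Z}^n\to\mathbb{Z}\cup\{-\infty\}$ be an integer-valued separable concave function with $\operatorname{dom}\Psi\neq\emptyset$. Assume that at least one of the minimum and the maximum in the following formula is finite. Then $$\min\{f(x)-\Psi(x)\mid x\in\mathbb{Z}^n\}=\max\{\Psi^{\circ}(p)-f^{\bullet}(p)\mid p\in\mathbb{Z}^n\}.$$
   Context: For $h:\mathbb{Z}^n\to\mathbb{R}\cup\{-\infty,+\infty\}$, $\operatorname{dom}h=\{x\in\mathbb{Z}^n\mid -\infty<h(x)<+\infty\}$. Integral convexity: for $x\in\mathbb{R}^n$ let $N(x)=\{z\in\mathbb{Z}^n\mid |x_i-z_i|<1\ (i=1,\dots,n)\}$. For $f:\mathbb{Z}^n\to\mathbb{R}\cup\{+\infty\}$ with $\operatorname{dom}f\ne\emptyset$, the local convex extension $\tilde f:\mathbb{R}^n\to\mathbb{R}\cup\{+\infty\}$ is $\tilde f(x)=\min\{\sum_{y\in N(x)}\lambda_y f(y)\mid \sum_{y\in N(x)}\lambda_y y=x,\ \sum_{y\in N(x)}\lambda_y=1,\ \lambda_y\ge 0\ (y\in N(x))\}$. The function $f$ is integrally convex if $\tilde f$ is convex on $\mathbb{R}^n$. Separable concave: $\Psi(x)=\psi_1(x_1)+\cdots+\psi_n(x_n)$ where each $\psi_i:\mathbb{Z}\to\mathbb{Z}\cup\{-\infty\}$ is a univariate discrete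 concave function, i.e., $\operatorname{dom}\psi_i$ is an interval of integers and $\psi_i(k-1)+\psi_i(k+1)\le 2\psi_i(k)$ for all $k\in\mathbb{Z}$. Conjugates: for $p\in\mathbb{Z}^n$, $f^{\bullet}(p)=\max\{\langle p,x\rangle-f(x)\mid x\in\mathbb{Z}^n\}\in\mathbb{Z}\cup\{+\infty\}$ and $\Psi^{\circ}(p)=\min\{\langle p,x\rangle-\Psi(x)\mid x\in\mathbb{Z}^n\}\in\mathbb{Z}\cup\{-\infty\}$, with $\langle p,x\rangle=\sum_i p_ix_i$. Here "max" and "min" stand for supremum and infimum and may take infinite values. In the formula, $f(x)-\Psi(x)=+\infty$ unless $x\in\operatorname{dom}f\cap\operatorname{dom}\Psi$, and $\Psi^{\circ}(p)-f^{\bullet}(p)=-\infty$ unless both terms are finite. Finiteness of the minimum means $\operatorname{dom}f\cap\operatorname{dom}\Psi\ne\emptyset$ and the values are bounded below (similarly for the maximum); since the values are integers, a finite minimum or maximum is attained. *)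

theory Defs
  imports "HOL-Analysis.Analysis"
begin

text \<open>
  Functions on the integer lattice with values in the reals extended by plus or minus infinity
  are modelled as \<^typ>\<open>int ^ 'n \<Rightarrow> ereal\<close>; restrictions on the codomain are stated explicitly.
\<close>

definition eff_dom :: "('a \<Rightarrow> ereal) \<Rightarrow> 'a set" where
  "eff_dom h = {x. - \<infinity> < h x \<and> h x < \<infinity>}"

definition ext_ints :: "ereal set" where
  "ext_ints = range (\<lambda>k::int. ereal (of_int k))"

definition vec_of_int :: "int ^ 'n \<Rightarrow> real ^ 'n" where
  "vec_of_int z = (\<chi> i. of_int (z $ i))"

definition int_inner :: "int ^ 'n \<Rightarrow> int ^ 'n \<Rightarrow> int" where
  "int_inner p x = (\<Sum>i\<in>UNIV. p $ i * x $ i)"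

definition int_nbhd :: "real ^ 'n \<Rightarrow> (int ^ 'n) set" where
  "int_nbhd x = {z. \<forall>i. \<bar>x $ i - of_int (z $ i)\<bar> < 1}"

text \<open>
  Since \<^prop>\<open>0 * \<infinity> = (0::ereal)\<close>, points with zero weight do not contribute, even where \<open>f\<close> is
  infinite. The set \<open>int_nbhd x\<close> is finite and has \<open>x\<close> in its convex hull, so for
  \<open>f\<close> avoiding \<open>-\<infinity>\<close> the infimum is a minimum and is not \<open>-\<infinity>\<close>.
\<close>

definition local_convex_ext :: "(int ^ 'n \<Rightarrow> ereal) \<Rightarrow> real ^ 'n \<Rightarrow> ereal" where
  "local_convex_ext f x =
     Inf {\<Sum>y\<in>int_nbhd x. ereal (l y) * f y | l.
            (\<Sum>y\<in>int_nbhd x. l y *\<^sub>R vec_of_int y) = x \<and>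
            (\<Sum>y\<in>int_nbhd x. l y) = 1 \<and>
            (\<forall>y\<in>int_nbhd x. 0 \<le> l y)}"

text \<open>Intended for functions that do not take the value \<open>-\<infinity>\<close>.\<close>

definition ext_convex :: "('a::real_vector \<Rightarrow> ereal) \<Rightarrow> bool" where
  "ext_convex g \<longleftrightarrow>
     (\<forall>x y. \<forall>t\<in>{0..1}. g ((1 - t) *\<^sub>R x + t *\<^sub>R y) \<le> ereal (1 - t) * g x + ereal t * g y)"

definition integrally_convex :: "(int ^ 'n \<Rightarrow> ereal) \<Rightarrow> bool" where
  "integrally_convex f \<longleftrightarrow>
     (\<forall>x. f x \<noteq> - \<infinity>) \<and> eff_dom f \<noteq> {} \<and> ext_convex (local_convex_ext f)"

definition int_discrete_concave :: "(int \<Rightarrow> ereal) \<Rightarrow> bool" where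
  "int_discrete_concave g \<longleftrightarrow>
     (\<forall>k. g k \<in> ext_ints \<union> {- \<infinity>}) \<and>
     (\<forall>a\<in>eff_dom g. \<forall>b\<in>eff_dom g. {a..b} \<subseteq> eff_dom g) \<and>
     (\<forall>k. g (k - 1) + g (k + 1) \<le> 2 * g k)"

definition int_separable_concave :: "(int ^ 'n \<Rightarrow> ereal) \<Rightarrow> bool" where
  "int_separable_concave \<Psi> \<longleftrightarrow>
     (\<exists>\<psi>. (\<forall>i. int_discrete_concave (\<psi> i)) \<and> (\<forall>x. \<Psi> x = (\<Sum>i\<in>UNIV. \<psi> i (x $ i))))"

definition convex_conj :: "(int ^ 'n \<Rightarrow> ereal) \<Rightarrow> int ^ 'n \<Rightarrow> ereal" where
  "convex_conj f p = (SUP x. ereal (of_int (int_inner p x)) - f x)"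

definition concave_conj :: "(int ^ 'n \<Rightarrow> ereal) \<Rightarrow> int ^ 'n \<Rightarrow> ereal" where
  "concave_conj \<Psi> p = (INF x. ereal (of_int (int_inner p x)) - \<Psi> x)"

end

theory Submission
  imports Defs
begin

text \<open>
  Let \<open>a\<close> minimise \<open>f - \<Psi>\<close>. The summands of \<open>\<Psi>\<close> are replaced one at a time by integral linear
  functions, keeping \<open>a\<close> a minimiser; at the end the slopes form a common integral subgradient,
  which is a dual solution. To replace \<open>\<psi>\<^sub>i\<close>, let \<open>h\<close> be \<open>f\<close> minus the other summands. A slope is
  admissible if it lies between finitely many integers, given by the values of \<open>h\<close> on the
  layers \<open>x\<^sub>i = a\<^sub>i - 1\<close> and \<open>x\<^sub>i = a\<^sub>i + 1\<close> near \<open>a\<close> and by the one-sided slopes of \<open>\<psi>\<^sub>i\<close> at \<open>a\<^sub>i\<close>.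
  These bounds are compatible: for \<open>d\<close> and \<open>e\<close> in the two layers, integral convexity at the
  midpoint of \<open>d\<close> and \<open>e\<close> only involves points with \<open>x\<^sub>i = a\<^sub>i\<close>. Subtracting a separable concave
  function preserves integral convexity on pairs of lattice points, since a univariate concave
  function agrees with an affine majorant on two consecutive integers.

  If the domains are disjoint, the same argument for the zero function on \<open>dom f\<close> and the negated
  \<open>l\<^sub>1\<close>-distance to the box \<open>dom \<Psi>\<close> gives an integral vector separating the domains with gap one,
  along which a finite dual value grows without bound.
\<close>

text \<open>An interval \<open>I\<close> and an \<open>int\<close>-valued \<open>\<psi>\<close>
  stand in for one extended-valued function, so that no infinities occur in the arithmetic. As
  \<open>I\<close> is an interval, the inequality only compares values on \<open>I\<close>.\<close>

definition discrete_concave_on :: "int set \<Rightarrow> (int \<Rightarrow> int) \<Rightarrow> bool" where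
  "discrete_concave_on I \<psi> \<longleftrightarrow>
     (\<forall>a\<in>I. \<forall>b\<in>I. {a..b} \<subseteq> I) \<and>
     (\<forall>k. k - 1 \<in> I \<longrightarrow> k + 1 \<in> I \<longrightarrow> \<psi> (k - 1) + \<psi> (k + 1) \<le> 2 * \<psi> k)"

text \<open>
  Convexity of the local convex extension tested on pairs of points of the effective domain \<open>D\<close>
  only. The slack \<open>\<epsilon>\<close> makes it unnecessary to know that the infimum defining the extension is
  attained.
\<close>

definition lattice_convex_on :: "(int ^ 'n) set \<Rightarrow> (int ^ 'n \<Rightarrow> int) \<Rightarrow> bool" where
  "lattice_convex_on D g \<longleftrightarrow>
     (\<forall>x\<in>D. \<forall>y\<in>D. \<forall>t\<in>{0..1::real}. \<forall>\<epsilon>>0. \<exists>W l. finite W \<and> W \<subseteq> D \<and>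
        (\<forall>w\<in>W. 0 \<le> l w \<and> (\<forall>i. \<bar>(1 - t) * of_int (x $ i) + t * of_int (y $ i) - of_int (w $ i)\<bar> < 1)) \<and>
        sum l W = 1 \<and>
        (\<forall>i. (\<Sum>w\<in>W. l w * of_int (w $ i)) = (1 - t) * of_int (x $ i) + t * of_int (y $ i)) \<and>
        (\<Sum>w\<in>W. l w * of_int (g w)) \<le> (1 - t) * of_int (g x) + t * of_int (g y) + \<epsilon>)"

lemma lattice_convex_onE:
  assumes "lattice_convex_on D g" "x \<in> D" "y \<in> D" "0 \<le> t" "t \<le> 1" "0 < \<epsilon>"
  obtains W l where "finite W" "W \<subseteq> D" "\<And>w. w \<in> W \<Longrightarrow> 0 \<le> l w"
    "\<And>w i. w \<in> W \<Longrightarrow> \<bar>(1 - t) * of_int (x $ i) + t * of_int (y $ i) - of_int (w $ i)\<bar> < 1"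
    "sum l W = (1::real)"
    "\<And>i. (\<Sum>w\<in>W. l w * of_int (w $ i)) = (1 - t) * of_int (x $ i) + t * of_int (y $ i)"
    "(\<Sum>w\<in>W. l w * of_int (g w)) \<le> (1 - t) * of_int (g x) + t * of_int (g y) + \<epsilon>"
proof -
  have t: "t \<in> {0..1}" using assms by simp
  note ex = assms(1)[unfolded lattice_convex_on_def, rule_format, OF assms(2,3) t assms(6)]
  then show thesis by (elim exE conjE) (rule that; (assumption | erule spec | (drule (1) bspec, elim conjE, (assumption | erule spec))))
qed

section \<open>Univariate discrete concave functions\<close>

text \<open>Reflection turns statements about points to the right of \<open>k\<close> into
  statements about points to its left.\<close>

lemma discrete_concave_on_uminus:
  assumes "discrete_concave_on I \<psi>"
  shows "discrete_concave_on (uminus ` I) (\<lambda>t. \<psi> (- t))"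
proof -
  have m: "t \<in> uminus ` I \<longleftrightarrow> - t \<in> I" for t :: int
    by (metis image_iff minus_minus)
  have "{a..b} \<subseteq> uminus ` I" if "- a \<in> I" "- b \<in> I" for a b
  proof
    fix t assume "t \<in> {a..b}"
    then have "- t \<in> {- b..- a}" by simp
    then have "- t \<in> I" using assms that unfolding discrete_concave_on_def by blast
    then show "t \<in> uminus ` I" by (simp add: m)
  qed
  moreover have "\<psi> (- (k - 1)) + \<psi> (- (k + 1)) \<le> 2 * \<psi> (- k)"
    if "- (k - 1) \<in> I" "- (k + 1) \<in> I" for k
  proof -
    have e: "- (k - 1) = - k + 1" "- (k + 1) = - k - 1" by auto
    have "- k - 1 \<in> I" "- k + 1 \<in> I" using that unfolding e by auto
    then have "\<psi> (- k - 1) + \<psi> (- k + 1) \<le> 2 * \<psi> (- k)"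
      using assms unfolding discrete_concave_on_def by blast
    then show ?thesis unfolding e by simp
  qed
  ultimately show ?thesis unfolding discrete_concave_on_def by (auto simp: m)
qed

text \<open>Concavity makes the increments nonincreasing, so a bound on the first increment after
  \<open>k\<close> bounds all later ones.\<close>

lemma discrete_concave_on_supergradient_ge:
  assumes c: "discrete_concave_on I \<psi>" and k: "k \<in> I"
    and s: "k + 1 \<in> I \<Longrightarrow> \<psi> (k + 1) \<le> \<psi> k + s"
    and t: "t \<in> I" "k \<le> t"
  shows "\<psi> t \<le> \<psi> k + s * (t - k)"
proof -
  \<comment> \<open>The second conjunct, a bound on the next increment, is what carries the
    induction forward.\<close>
  have "t \<in> I \<longrightarrow> (\<psi> t \<le> \<psi> k + s * (t - k) \<and> (t + 1 \<in> I \<longrightarrow> \<psi> (t + 1) \<le> \<psi> t + s))"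
    using \<open>k \<le> t\<close>
  proof (induction t rule: int_ge_induct)
    case base
    then show ?case using s by simp
  next
    case (step j)
    show ?case
    proof
      assume j1: "j + 1 \<in> I"
      then have "j \<in> {k..j + 1}" "{k..j+1} \<subseteq> I"
        using step.hyps c k unfolding discrete_concave_on_def by auto
      then have "j \<in> I" by blast
      then have 1: "\<psi> j \<le> \<psi> k + s * (j - k)" "\<psi> (j + 1) \<le> \<psi> j + s" using step.IH j1 by auto
      have 2: "\<psi> j + \<psi> (j + 2) \<le> 2 * \<psi> (j + 1)" if "j + 2 \<in> I"
      proof -
        have "\<forall>k. k - 1 \<in> I \<longrightarrow> k + 1 \<in> I \<longrightarrow> \<psi> (k - 1) + \<psi> (k + 1) \<le> 2 * \<psi> k"
          using c unfolding discrete_concave_on_def by blast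
        from this[rule_format, of "j + 1"] show ?thesis
          using \<open>j \<in> I\<close> that by (simp add: add.assoc)
      qed
      show "\<psi> (j + 1) \<le> \<psi> k + s * (j + 1 - k) \<and>
        (j + 1 + 1 \<in> I \<longrightarrow> \<psi> (j + 1 + 1) \<le> \<psi> (j + 1) + s)"
        using 1 2 by (auto simp: algebra_simps)
    qed
  qed
  then show ?thesis using t by blast
qed

text \<open>To the right of \<open>k\<close> the preceding lemma applies, to the left its
  reflection. A neighbour of \<open>k\<close> outside \<open>I\<close> imposes no condition on
  \<open>s\<close>.\<close>

lemma discrete_concave_on_supergradient:
  assumes c: "discrete_concave_on I \<psi>" and k: "k \<in> I"
    and s: "k + 1 \<in> I \<Longrightarrow> \<psi> (k + 1) \<le> \<psi> k + s"
    and s': "k - 1 \<in> I \<Longrightarrow> \<psi> (k - 1) \<le> \<psi> k - s"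
    and t: "t \<in> I"
  shows "\<psi> t \<le> \<psi> k + s * (t - k)"
proof (cases "k \<le> t")
  case True
  then show ?thesis using discrete_concave_on_supergradient_ge[OF c k s t] by blast
next
  case False
  have m: "t \<in> uminus ` I \<longleftrightarrow> - t \<in> I" for t :: int
    by (metis image_iff minus_minus)
  have "\<psi> (- (- t)) \<le> \<psi> (- (- k)) + (- s) * (- t - (- k))"
  proof (rule discrete_concave_on_supergradient_ge[OF discrete_concave_on_uminus[OF c]])
    show "\<psi> (- (- k + 1)) \<le> \<psi> (- (- k)) + - s" if "- k + 1 \<in> uminus ` I"
      using that s' by (simp add: m algebra_simps)
  qed (use False k t in auto)
  then show ?thesis by (simp add: algebra_simps)
qed

text \<open>All \<open>v w\<close> lie at distance less than one from their barycentre
  \<open>z\<close>, so they only take the two values next to \<open>z\<close>. There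
  \<open>\<psi>\<close> agrees with an affine majorant, and affine functions commute with weighted
  means.\<close>

lemma discrete_concave_on_local_jensen:
  fixes v :: "'a \<Rightarrow> int" and l :: "'a \<Rightarrow> real"
  assumes c: "discrete_concave_on I \<psi>" and x: "x \<in> I" and y: "y \<in> I"
    and t: "0 \<le> t" "t \<le> 1"
    and l: "\<And>w. w \<in> W \<Longrightarrow> 0 \<le> l w" "sum l W = 1"
    and near: "\<And>w. w \<in> W \<Longrightarrow> \<bar>(1 - t) * of_int x + t * of_int y - of_int (v w)\<bar> < 1"
    and bary: "(\<Sum>w\<in>W. l w * of_int (v w)) = (1 - t) * of_int x + t * of_int y"
  shows "\<And>w. w \<in> W \<Longrightarrow> v w \<in> I"
    and "(1 - t) * of_int (\<psi> x) + t * of_int (\<psi> y) \<le> (\<Sum>w\<in>W. l w * of_int (\<psi> (v w)))"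
proof -
  define z where "z = (1 - t) * of_int x + t * of_int y"
  have zmin: "of_int (min x y) \<le> z"
  proof -
    have "(1 - t) * of_int (min x y) + t * of_int (min x y) \<le> z"
      unfolding z_def using t by (intro add_mono mult_left_mono) auto
    then show ?thesis by (simp add: algebra_simps)
  qed
  have zmax: "z \<le> of_int (max x y)"
  proof -
    have "z \<le> (1 - t) * of_int (max x y) + t * of_int (max x y)"
      unfolding z_def using t by (intro add_mono mult_left_mono) auto
    then show ?thesis by (simp add: algebra_simps)
  qed
  have "min x y \<in> I" "max x y \<in> I" using x y by (auto simp: min_def max_def)
  then have box: "{min x y..max x y} \<subseteq> I" using c unfolding discrete_concave_on_def by blast
  have vbox: "k \<in> I" if "\<bar>z - of_int k\<bar> < 1" for k
  proof -
    have "real_of_int (min x y) < of_int (k + 1)" "real_of_int k < of_int (max x y + 1)"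
      using that zmin zmax by auto
    then have "min x y < k + 1" "k < max x y + 1" by (simp_all only: of_int_less_iff)
    then have "k \<in> {min x y..max x y}" by simp
    then show ?thesis using box by blast
  qed
  then show "\<And>w. w \<in> W \<Longrightarrow> v w \<in> I" using near unfolding z_def by blast
  define k where "k = \<lfloor>z\<rfloor>"
  have kz: "of_int k \<le> z" "z < of_int k + 1" unfolding k_def by linarith+
  have k: "k \<in> I" using kz by (intro vbox) linarith
  have conc: "\<psi> (k - 1) + \<psi> (k + 1) \<le> 2 * \<psi> k" if "k - 1 \<in> I" "k + 1 \<in> I"
    using c that unfolding discrete_concave_on_def by blast
  \<comment> \<open>If \<open>k + 1\<close> is in \<open>I\<close>, the line must interpolate
    \<open>\<psi>\<close> at \<open>k\<close> and \<open>k + 1\<close>. Otherwise every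
    \<open>v w\<close> equals \<open>k\<close>, and any supergradient at \<open>k\<close> will
    do.\<close>
  define s where "s = (if k + 1 \<in> I then \<psi> (k + 1) - \<psi> k else if k - 1 \<in> I then \<psi> k - \<psi> (k - 1) else 0)"
  have sup: "\<psi> t \<le> \<psi> k + s * (t - k)" if "t \<in> I" for t
    by (rule discrete_concave_on_supergradient[OF c k _ _ that]) (use conc in \<open>auto simp: s_def\<close>)
  have eq: "\<psi> (v w) = \<psi> k + s * (v w - k)" if "w \<in> W" for w
  proof -
    have n: "\<bar>z - of_int (v w)\<bar> < 1" using near[OF that] unfolding z_def .
    have "real_of_int k < of_int (v w + 1)" "real_of_int (v w) < of_int (k + 2)"
      using n kz by auto
    then have "v w = k \<or> v w = k + 1" unfolding of_int_less_iff by linarith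
    moreover have "v w \<in> I" using vbox[OF n] .
    ultimately show ?thesis unfolding s_def by auto
  qed
  have supr: "real_of_int (\<psi> t) \<le> of_int (\<psi> k) + of_int s * (of_int t - of_int k)" if "t \<in> I" for t
    using sup[OF that] by (metis of_int_add of_int_diff of_int_le_iff of_int_mult)
  have "(1 - t) * of_int (\<psi> x) + t * of_int (\<psi> y)
    \<le> (1 - t) * (of_int (\<psi> k) + of_int s * (of_int x - of_int k))
      + t * (of_int (\<psi> k) + of_int s * (of_int y - of_int k))"
    using t x y by (intro add_mono mult_left_mono supr) auto
  \<comment> \<open>The factor \<open>sum l W\<close> is one; it lets the constant term be
    distributed over the weights.\<close>
  also have "\<dots> = (of_int (\<psi> k) - of_int s * of_int k) * sum l W + of_int s * (\<Sum>w\<in>W. l w * of_int (v w))"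
    unfolding bary \<open>sum l W = 1\<close> by (simp add: algebra_simps)
  also have "\<dots> = (\<Sum>w\<in>W. l w * of_int (\<psi> k + s * (v w - k)))"
    unfolding sum_distrib_left sum.distrib[symmetric]
    by (intro sum.cong) (auto simp: algebra_simps)
  also have "\<dots> = (\<Sum>w\<in>W. l w * of_int (\<psi> (v w)))"
    by (intro sum.cong) (auto simp: eq)
  finally show "(1 - t) * of_int (\<psi> x) + t * of_int (\<psi> y) \<le> (\<Sum>w\<in>W. l w * of_int (\<psi> (v w)))" .
qed

section \<open>Subtracting separable concave functions\<close>

text \<open>The points and weights that witness convexity of \<open>g\<close> serve again: in each
  coordinate of \<open>J\<close> they satisfy the assumptions of
  \<open>discrete_concave_on_local_jensen\<close>, which keeps them in \<open>I i\<close> and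
  estimates the subtracted summand.\<close>

lemma lattice_convex_on_diff_separable:
  fixes g :: "int ^ 'n \<Rightarrow> int"
  assumes g: "lattice_convex_on D g" and \<psi>: "\<And>i. i \<in> J \<Longrightarrow> discrete_concave_on (I i) (\<psi> i)"
  shows "lattice_convex_on {x \<in> D. \<forall>i\<in>J. x $ i \<in> I i} (\<lambda>x. g x - (\<Sum>i\<in>J. \<psi> i (x $ i)))"
  unfolding lattice_convex_on_def
proof (intro ballI allI impI)
  fix x y t and \<epsilon> :: real
  assume x: "x \<in> {x \<in> D. \<forall>i\<in>J. x $ i \<in> I i}" and y: "y \<in> {x \<in> D. \<forall>i\<in>J. x $ i \<in> I i}"
    and t: "t \<in> {0..1::real}" and \<epsilon>: "0 < \<epsilon>"
  have xy: "x \<in> D" "y \<in> D" and t01: "0 \<le> t" "t \<le> 1" using x y t by auto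
  obtain W l where W: "finite W" "W \<subseteq> D" "\<And>w. w \<in> W \<Longrightarrow> 0 \<le> l w"
    "\<And>w i. w \<in> W \<Longrightarrow> \<bar>(1 - t) * of_int (x $ i) + t * of_int (y $ i) - of_int (w $ i)\<bar> < 1"
    "sum l W = (1::real)"
    "\<And>i. (\<Sum>w\<in>W. l w * of_int (w $ i)) = (1 - t) * of_int (x $ i) + t * of_int (y $ i)"
    "(\<Sum>w\<in>W. l w * of_int (g w)) \<le> (1 - t) * of_int (g x) + t * of_int (g y) + \<epsilon>"
    by (rule lattice_convex_onE[OF g xy t01 \<epsilon>]) (rule that)
  have mem: "w $ i \<in> I i" if "w \<in> W" "i \<in> J" for w i
    by (rule discrete_concave_on_local_jensen(1)[OF \<psi>[OF that(2)] _ _ _ _ W(3) W(5) W(4) W(6) that(1)])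
      (use x y t that in auto)
  have le: "(1 - t) * of_int (\<psi> i (x $ i)) + t * of_int (\<psi> i (y $ i))
      \<le> (\<Sum>w\<in>W. l w * of_int (\<psi> i (w $ i)))" if "i \<in> J" for i
    by (rule discrete_concave_on_local_jensen(2)[OF \<psi>[OF that] _ _ _ _ W(3) W(5) W(4) W(6)])
      (use x y t that in auto)
  have "(\<Sum>w\<in>W. l w * of_int (g w - (\<Sum>i\<in>J. \<psi> i (w $ i))))
      = (\<Sum>w\<in>W. l w * of_int (g w)) - (\<Sum>w\<in>W. \<Sum>i\<in>J. l w * of_int (\<psi> i (w $ i)))"
    by (simp add: sum_subtractf right_diff_distrib sum_distrib_left)
  also have "\<dots> = (\<Sum>w\<in>W. l w * of_int (g w)) - (\<Sum>i\<in>J. \<Sum>w\<in>W. l w * of_int (\<psi> i (w $ i)))"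
    by (subst sum.swap) simp
  also have "\<dots> \<le> ((1 - t) * of_int (g x) + t * of_int (g y) + \<epsilon>)
      - (\<Sum>i\<in>J. (1 - t) * of_int (\<psi> i (x $ i)) + t * of_int (\<psi> i (y $ i)))"
    by (intro diff_mono W(7) sum_mono le)
  also have "(\<Sum>i\<in>J. (1 - t) * of_int (\<psi> i (x $ i)) + t * of_int (\<psi> i (y $ i)))
      = (1 - t) * of_int (\<Sum>i\<in>J. \<psi> i (x $ i)) + t * of_int (\<Sum>i\<in>J. \<psi> i (y $ i))"
    by (simp add: sum.distrib sum_distrib_left)
  also have "((1 - t) * of_int (g x) + t * of_int (g y) + \<epsilon>) - \<dots> = (1 - t) * of_int (g x - (\<Sum>i\<in>J. \<psi> i (x $ i)))
      + t * of_int (g y - (\<Sum>i\<in>J. \<psi> i (y $ i))) + \<epsilon>"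
    by (simp add: algebra_simps)
  finally have ineq: "(\<Sum>w\<in>W. l w * of_int (g w - (\<Sum>i\<in>J. \<psi> i (w $ i))))
      \<le> (1 - t) * of_int (g x - (\<Sum>i\<in>J. \<psi> i (x $ i)))
        + t * of_int (g y - (\<Sum>i\<in>J. \<psi> i (y $ i))) + \<epsilon>" .
  have sub: "W \<subseteq> {x \<in> D. \<forall>i\<in>J. x $ i \<in> I i}" using W(2) mem by blast
  show "\<exists>W l. finite W \<and> W \<subseteq> {x \<in> D. \<forall>i\<in>J. x $ i \<in> I i} \<and>
        (\<forall>w\<in>W. 0 \<le> l w \<and> (\<forall>i. \<bar>(1 - t) * of_int (x $ i) + t * of_int (y $ i) - of_int (w $ i)\<bar> < 1)) \<and>
        sum l W = 1 \<and>
        (\<forall>i. (\<Sum>w\<in>W. l w * of_int (w $ i)) = (1 - t) * of_int (x $ i) + t * of_int (y $ i)) \<and>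
        (\<Sum>w\<in>W. l w * of_int (g w - (\<Sum>i\<in>J. \<psi> i (w $ i))))
          \<le> (1 - t) * of_int (g x - (\<Sum>i\<in>J. \<psi> i (x $ i)))
            + t * of_int (g y - (\<Sum>i\<in>J. \<psi> i (y $ i))) + \<epsilon>"
    by (intro exI[of _ W] exI[of _ l] conjI ballI allI) (rule W sub ineq | assumption)+
qed

section \<open>Replacing one concave summand by a linear function\<close>

text \<open>This is the source of integral slopes: finitely many integer bounds have an extreme one,
  which can itself be taken as the slope.\<close>

lemma int_between_finite_sets:
  fixes L U :: "int set"
  assumes "finite L" "finite U" "\<And>l u. l \<in> L \<Longrightarrow> u \<in> U \<Longrightarrow> l \<le> u"
  obtains p where "\<And>l. l \<in> L \<Longrightarrow> l \<le> p" "\<And>u. u \<in> U \<Longrightarrow> p \<le> u"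
proof (cases "U = {}")
  case True
  \<comment> \<open>Inserting \<open>0\<close> covers the case that \<open>L\<close> is empty as
    well.\<close>
  then show thesis using that[of "Max (insert 0 L)"] assms by simp
next
  case False
  then show thesis using that[of "Min U"] assms by simp
qed

lemma finite_unit_box: "finite {y :: int ^ 'n. \<forall>j. \<bar>y $ j - a $ j\<bar> \<le> 1}"
proof (rule finite_subset)
  show "{y. \<forall>j. \<bar>y $ j - a $ j\<bar> \<le> 1} \<subseteq> vec_lambda ` (\<Pi>\<^sub>E j\<in>UNIV. {a $ j - 1..a $ j + 1})"
  proof
    fix y assume y: "y \<in> {y. \<forall>j. \<bar>y $ j - a $ j\<bar> \<le> 1}"
    have "a $ j - 1 \<le> y $ j \<and> y $ j \<le> a $ j + 1" for j
      using y[unfolded mem_Collect_eq, rule_format, of j] by linarith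
    then have "vec_nth y \<in> (\<Pi>\<^sub>E j\<in>UNIV. {a $ j - 1..a $ j + 1})" by auto
    then show "y \<in> vec_lambda ` (\<Pi>\<^sub>E j\<in>UNIV. {a $ j - 1..a $ j + 1})"
      by (metis image_eqI vec_nth_inverse)
  qed
qed (intro finite_imageI finite_PiE, auto)

text \<open>The midpoint of \<open>d\<close> and \<open>e\<close> has \<open>i\<close>-th coordinate
  exactly \<open>k\<close>, and an integer at distance less than one from \<open>k\<close> is
  \<open>k\<close>. So the witnesses of convexity all lie in the layer where \<open>c\<close> is a
  lower bound.\<close>

lemma lattice_convex_on_midpoint:
  assumes h: "lattice_convex_on D h" and d: "d \<in> D" "d $ i = k + 1" and e: "e \<in> D" "e $ i = k - 1"
    and c: "\<And>w. w \<in> D \<Longrightarrow> w $ i = k \<Longrightarrow> c \<le> h w"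
  shows "2 * c \<le> h d + h e"
proof -
  have half: "(0::real) \<le> 1/2" "(1/2::real) \<le> 1" by auto
  have "real_of_int c \<le> (of_int (h d) + of_int (h e)) / 2 + \<epsilon>" if \<epsilon>: "0 < \<epsilon>" for \<epsilon>
  proof -
    obtain W l where W: "finite W" "W \<subseteq> D" "\<And>w. w \<in> W \<Longrightarrow> 0 \<le> l w"
      "\<And>w i. w \<in> W \<Longrightarrow> \<bar>(1 - 1/2 :: real) * of_int (d $ i) + 1/2 * of_int (e $ i) - of_int (w $ i)\<bar> < 1"
      "sum l W = (1::real)"
      "\<And>i. (\<Sum>w\<in>W. l w * of_int (w $ i)) = (1 - 1/2) * of_int (d $ i) + 1/2 * of_int (e $ i)"
      "(\<Sum>w\<in>W. l w * of_int (h w)) \<le> (1 - 1/2) * of_int (h d) + 1/2 * of_int (h e) + \<epsilon>"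
      by (rule lattice_convex_onE[OF h d(1) e(1) half \<epsilon>]) (rule that)
    have wi: "w $ i = k" if "w \<in> W" for w
    proof -
      have "\<bar>real_of_int (k - w $ i)\<bar> < 1" using W(4)[OF that, of i] d e by (simp add: field_simps)
      then show ?thesis by linarith
    qed
    have "real_of_int c = (\<Sum>w\<in>W. l w * of_int c)"
      using W(5) by (simp add: sum_distrib_right[symmetric])
    also have "\<dots> \<le> (\<Sum>w\<in>W. l w * of_int (h w))"
      using c W wi by (intro sum_mono mult_left_mono) auto
    finally show ?thesis using W(7) by (simp add: field_simps)
  qed
  then have "real_of_int c \<le> (of_int (h d) + of_int (h e)) / 2" by (rule field_le_epsilon)
  then have "real_of_int (2 * c) \<le> of_int (h d + h e)" by simp
  then show ?thesis by (simp only: of_int_le_iff)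
qed

text \<open>As for convex functions, an affine minorant touching at \<open>a\<close> need only be
  checked near \<open>a\<close>: a point of the segment to \<open>x\<close> close to
  \<open>a\<close> is an average of lattice points in the unit box around \<open>a\<close>. Hence
  finitely many inequalities decide which slopes are admissible.\<close>

lemma lattice_convex_on_local_to_global:
  fixes a :: "int ^ 'n"
  assumes h: "lattice_convex_on D h" and a: "a \<in> D" and x: "x \<in> D"
    and loc: "\<And>y. y \<in> D \<Longrightarrow> (\<And>j. \<bar>y $ j - a $ j\<bar> \<le> 1) \<Longrightarrow> h a + p * (y $ i - a $ i) \<le> h y"
  shows "h a + p * (x $ i - a $ i) \<le> h x"
proof -
  \<comment> \<open>The step \<open>1 / m\<close> from \<open>a\<close> towards \<open>x\<close> is so short that all neighbours are within distance one of \<open>a\<close>.\<close>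
  define m where "m = real_of_int (1 + (\<Sum>j\<in>UNIV. \<bar>x $ j - a $ j\<bar>))"
  have m: "\<bar>real_of_int (x $ j) - of_int (a $ j)\<bar> < m" for j
  proof -
    have "\<bar>x $ j - a $ j\<bar> \<le> (\<Sum>j\<in>UNIV. \<bar>x $ j - a $ j\<bar>)"
      by (rule member_le_sum) auto
    then show ?thesis unfolding m_def by linarith
  qed
  have m1: "1 \<le> m" unfolding m_def by (simp add: sum_nonneg)
  \<comment> \<open>The common factor \<open>1 / m\<close> stays on both sides until the slack is
    gone, as \<open>field_le_epsilon\<close> expects a bare \<open>\<epsilon>\<close>.\<close>
  have "of_int (p * (x $ i - a $ i)) / m \<le> of_int (h x - h a) / m + \<epsilon>" if \<epsilon>: "0 < \<epsilon>" for \<epsilon>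
  proof -
    define t where "t = 1 / m"
    have t: "0 \<le> t" "t \<le> 1" unfolding t_def using m1 by auto
    obtain W l where W: "finite W" "W \<subseteq> D" "\<And>w. w \<in> W \<Longrightarrow> 0 \<le> l w"
      "\<And>w i. w \<in> W \<Longrightarrow> \<bar>(1 - t) * of_int (a $ i) + t * of_int (x $ i) - of_int (w $ i)\<bar> < 1"
      "sum l W = (1::real)"
      "\<And>i. (\<Sum>w\<in>W. l w * of_int (w $ i)) = (1 - t) * of_int (a $ i) + t * of_int (x $ i)"
      "(\<Sum>w\<in>W. l w * of_int (h w)) \<le> (1 - t) * of_int (h a) + t * of_int (h x) + \<epsilon>"
      by (rule lattice_convex_onE[OF h a x t \<epsilon>]) (rule that)
    have near: "\<bar>w $ j - a $ j\<bar> \<le> 1" if "w \<in> W" for w j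
    proof -
      have 1: "\<bar>t * (of_int (x $ j) - of_int (a $ j))\<bar> < 1"
        using m[of j] m1 unfolding t_def by (simp add: abs_mult field_simps)
      have "\<bar>real_of_int (w $ j - a $ j)\<bar> < 2"
        using W(4)[OF that, of j] 1 by (simp add: algebra_simps)
      then show ?thesis by linarith
    qed
    have "real_of_int (h a) + of_int p * (t * of_int (x $ i - a $ i))
        = (of_int (h a) - of_int p * of_int (a $ i)) * sum l W + of_int p * (\<Sum>w\<in>W. l w * of_int (w $ i))"
      unfolding W(6) W(5) by (simp add: algebra_simps)
    also have "\<dots> = (\<Sum>w\<in>W. l w * of_int (h a + p * (w $ i - a $ i)))"
      unfolding sum_distrib_left sum.distrib[symmetric]
      by (intro sum.cong) (auto simp: algebra_simps)
    also have "\<dots> \<le> (\<Sum>w\<in>W. l w * of_int (h w))"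
      using W near by (intro sum_mono mult_left_mono of_int_le_iff[THEN iffD2] loc) auto
    finally have "of_int p * (t * of_int (x $ i - a $ i)) \<le> t * of_int (h x - h a) + \<epsilon>"
      using W(7) by (simp add: algebra_simps)
    then show ?thesis unfolding t_def by simp
  qed
  then have "real_of_int (p * (x $ i - a $ i)) / m \<le> of_int (h x - h a) / m" by (rule field_le_epsilon)
  then have "real_of_int (p * (x $ i - a $ i)) \<le> of_int (h x - h a)"
    using m1 by (simp add: divide_le_cancel)
  then show ?thesis unfolding of_int_le_iff by simp
qed

text \<open>Both conclusions reduce to bounds on \<open>p\<close> by integers. Two bounds from
  \<open>h\<close> are compatible by the midpoint inequality, two from \<open>\<psi>\<close> by
  concavity, and one of each kind by minimality of \<open>a\<close>.\<close>

lemma lattice_convex_on_linearize: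
  fixes a :: "int ^ 'n"
  assumes h: "lattice_convex_on D h" and \<psi>: "discrete_concave_on I \<psi>"
    and a: "a \<in> D" "a $ i \<in> I"
    and min: "\<And>x. x \<in> D \<Longrightarrow> x $ i \<in> I \<Longrightarrow> h a - \<psi> (a $ i) \<le> h x - \<psi> (x $ i)"
  obtains p where "\<And>x. x \<in> D \<Longrightarrow> h a + p * (x $ i - a $ i) \<le> h x"
    and "\<And>t. t \<in> I \<Longrightarrow> \<psi> t \<le> \<psi> (a $ i) + p * (t - a $ i)"
proof -
  define k where "k = a $ i"
  define B where "B = D \<inter> {y. \<forall>j. \<bar>y $ j - a $ j\<bar> \<le> 1}"
  have finB: "finite B" unfolding B_def using finite_unit_box by blast
  \<comment> \<open>For \<open>h\<close>, the layer \<open>k - 1\<close> bounds the slope from below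
    and the layer \<open>k + 1\<close> from above; for \<open>\<psi>\<close> the sides are
    exchanged.\<close>
  define L where "L = (\<lambda>y. h a - h y) ` {y \<in> B. y $ i = k - 1} \<union> (if k + 1 \<in> I then {\<psi> (k + 1) - \<psi> k} else {})"
  define U where "U = (\<lambda>y. h y - h a) ` {y \<in> B. y $ i = k + 1} \<union> (if k - 1 \<in> I then {\<psi> k - \<psi> (k - 1)} else {})"
  \<comment> \<open>In the layer through \<open>a\<close> the terms in \<open>\<psi>\<close> cancel,
    so \<open>a\<close> minimises \<open>h\<close> there.\<close>
  have base: "h a \<le> h w" if "w \<in> D" "w $ i = k" for w
    using min[of w] that a by (simp add: k_def)
  have conc: "\<psi> (k - 1) + \<psi> (k + 1) \<le> 2 * \<psi> k" if "k - 1 \<in> I" "k + 1 \<in> I"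
    using \<psi> that unfolding discrete_concave_on_def by blast
  have LU: "l \<le> u" if lu: "l \<in> L" "u \<in> U" for l u
  proof -
    consider (1) e where "e \<in> D" "e $ i = k - 1" "l = h a - h e"
      | (2) "k + 1 \<in> I" "l = \<psi> (k + 1) - \<psi> k"
      using lu unfolding L_def B_def by (auto split: if_splits)
    note l = this
    consider (1) d where "d \<in> D" "d $ i = k + 1" "u = h d - h a"
      | (2) "k - 1 \<in> I" "u = \<psi> k - \<psi> (k - 1)"
      using lu unfolding U_def B_def by (auto split: if_splits)
    note u = this
    show ?thesis
    proof (cases rule: l)
      case l1: (1 e)
      show ?thesis
      proof (cases rule: u)
        case (1 d)
        have "2 * h a \<le> h d + h e"
          by (rule lattice_convex_on_midpoint[OF h 1(1,2) l1(1,2) base])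
        then show ?thesis using 1 l1 by simp
      next
        case 2
        then show ?thesis using min[of e] l1 by (auto simp: k_def)
      qed
    next
      case l2: 2
      show ?thesis
      proof (cases rule: u)
        case (1 d)
        then show ?thesis using min[of d] l2 by (auto simp: k_def)
      next
        case 2
        then show ?thesis using conc l2 by auto
      qed
    qed
  qed
  have "finite L" "finite U" unfolding L_def U_def using finB by auto
  then obtain p where p: "\<And>l. l \<in> L \<Longrightarrow> l \<le> p" "\<And>u. u \<in> U \<Longrightarrow> p \<le> u"
    using int_between_finite_sets LU by metis
  have glob: "h a + p * (x $ i - a $ i) \<le> h x" if "x \<in> D" for x
  proof (rule lattice_convex_on_local_to_global[OF h a(1) that])
    fix y assume y: "y \<in> D" "\<And>j. \<bar>y $ j - a $ j\<bar> \<le> 1"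
    have yB: "y \<in> B" using y unfolding B_def by blast
    consider "y $ i = k - 1" | "y $ i = k" | "y $ i = k + 1"
      using y(2)[of i] unfolding k_def by linarith
    then show "h a + p * (y $ i - a $ i) \<le> h y"
    proof cases
      case 1
      then have "h a - h y \<in> L" using yB unfolding L_def by blast
      from p(1)[OF this] show ?thesis using 1 by (simp add: k_def)
    next
      case 2
      then show ?thesis using base[OF y(1)] by (simp add: k_def)
    next
      case 3
      then have "h y - h a \<in> U" using yB unfolding U_def by blast
      from p(2)[OF this] show ?thesis using 3 by (simp add: k_def)
    qed
  qed
  have "\<psi> t \<le> \<psi> k + p * (t - k)" if "t \<in> I" for t
  proof (rule discrete_concave_on_supergradient[OF \<psi> _ _ _ that])
    show "k \<in> I" using a by (simp add: k_def)
    show "\<psi> (k + 1) \<le> \<psi> k + p" if "k + 1 \<in> I"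
      using p(1)[of "\<psi> (k + 1) - \<psi> k"] that unfolding L_def by simp
    show "\<psi> (k - 1) \<le> \<psi> k - p" if "k - 1 \<in> I"
      using p(2)[of "\<psi> k - \<psi> (k - 1)"] that unfolding U_def by simp
  qed
  then show thesis using that[of p] glob unfolding k_def by simp
qed

section \<open>A common integral gradient\<close>

text \<open>Each step of the induction on \<open>J\<close> finds the slope of one coordinate and
  absorbs the resulting linear function into \<open>g\<close>, which is why \<open>g\<close> is
  generalised.\<close>

lemma lattice_convex_on_separating_gradient:
  fixes a :: "int ^ 'n"
  assumes "finite J"
    and "lattice_convex_on D g"
    and "\<And>i. i \<in> J \<Longrightarrow> discrete_concave_on (I i) (\<psi> i)"
    and "a \<in> D" and "\<And>i. i \<in> J \<Longrightarrow> a $ i \<in> I i"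
    and "\<And>x. x \<in> D \<Longrightarrow> \<forall>i\<in>J. x $ i \<in> I i \<Longrightarrow>
      g a - (\<Sum>i\<in>J. \<psi> i (a $ i)) \<le> g x - (\<Sum>i\<in>J. \<psi> i (x $ i))"
  shows "\<exists>p. (\<forall>x\<in>D. g a + (\<Sum>i\<in>J. p i * (x $ i - a $ i)) \<le> g x) \<and>
    (\<forall>i\<in>J. \<forall>t\<in>I i. \<psi> i t \<le> \<psi> i (a $ i) + p i * (t - a $ i))"
  using assms
proof (induction J arbitrary: g rule: finite_induct)
  case empty
  then show ?case by simp
next
  case (insert i J)
  \<comment> \<open>Coordinate \<open>i\<close> is left free: the inequality for \<open>q\<close>
    has to hold outside \<open>I i\<close> too, since the induction hypothesis restricts only the
    coordinates in \<open>J\<close>.\<close>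
  define D' where "D' = {x \<in> D. \<forall>i\<in>J. x $ i \<in> I i}"
  define h where "h x = g x - (\<Sum>i\<in>J. \<psi> i (x $ i))" for x
  have h: "lattice_convex_on D' h"
    unfolding D'_def h_def using insert.prems by (intro lattice_convex_on_diff_separable) auto
  obtain q where q: "\<And>x. x \<in> D' \<Longrightarrow> h a + q * (x $ i - a $ i) \<le> h x"
    "\<And>t. t \<in> I i \<Longrightarrow> \<psi> i t \<le> \<psi> i (a $ i) + q * (t - a $ i)"
  proof (rule lattice_convex_on_linearize[OF h, of "I i" "\<psi> i" a i])
    fix x assume "x \<in> D'" "x $ i \<in> I i"
    then show "h a - \<psi> i (a $ i) \<le> h x - \<psi> i (x $ i)"
      using insert.prems(5)[of x] insert.hyps by (simp add: D'_def h_def)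
  qed (use insert.prems in \<open>auto simp: D'_def\<close>)
  define g' where "g' x = g x - q * x $ i" for x
  \<comment> \<open>A linear function is concave on all integers, so subtracting it does not shrink
    \<open>D\<close>.\<close>
  have lin: "discrete_concave_on UNIV (\<lambda>t. q * t)"
    unfolding discrete_concave_on_def by (simp add: algebra_simps)
  have g': "lattice_convex_on D g'"
    using lattice_convex_on_diff_separable[OF insert.prems(1), of "{i}" "\<lambda>_. UNIV" "\<lambda>_ t. q * t"] lin
    by (simp add: g'_def[abs_def])
  have "\<exists>p. (\<forall>x\<in>D. g' a + (\<Sum>i\<in>J. p i * (x $ i - a $ i)) \<le> g' x) \<and>
    (\<forall>i\<in>J. \<forall>t\<in>I i. \<psi> i t \<le> \<psi> i (a $ i) + p i * (t - a $ i))"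
  proof (rule insert.IH[OF g'])
    fix x assume "x \<in> D" "\<forall>i\<in>J. x $ i \<in> I i"
    then have "x \<in> D'" unfolding D'_def by blast
    from q(1)[OF this]
    show "g' a - (\<Sum>i\<in>J. \<psi> i (a $ i)) \<le> g' x - (\<Sum>i\<in>J. \<psi> i (x $ i))"
      by (simp add: h_def g'_def algebra_simps)
  qed (use insert.prems in auto)
  then obtain p where p: "\<And>x. x \<in> D \<Longrightarrow> g' a + (\<Sum>i\<in>J. p i * (x $ i - a $ i)) \<le> g' x"
    "\<And>i t. i \<in> J \<Longrightarrow> t \<in> I i \<Longrightarrow> \<psi> i t \<le> \<psi> i (a $ i) + p i * (t - a $ i)" by blast
  have eq: "(\<Sum>j\<in>insert i J. (p(i := q)) j * (x $ j - a $ j))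
      = q * (x $ i - a $ i) + (\<Sum>j\<in>J. p j * (x $ j - a $ j))" for x
  proof -
    have "(\<Sum>j\<in>J. (p(i := q)) j * (x $ j - a $ j)) = (\<Sum>j\<in>J. p j * (x $ j - a $ j))"
      using insert.hyps by (intro sum.cong) auto
    then show ?thesis using insert.hyps by simp
  qed
  show ?case
  proof (intro exI[of _ "p(i := q)"] conjI ballI)
    fix x assume "x \<in> D"
    from p(1)[OF this] show "g a + (\<Sum>j\<in>insert i J. (p(i := q)) j * (x $ j - a $ j)) \<le> g x"
      unfolding eq by (simp add: g'_def algebra_simps)
  next
    fix j t assume "j \<in> insert i J" "t \<in> I j"
    then show "\<psi> j t \<le> \<psi> j (a $ j) + (p(i := q)) j * (t - a $ j)"
      using p(2) q(2) by (cases "j = i") auto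
  qed
qed

text \<open>The one-dimensional supergradient inequalities add up to an inequality for the inner
  product with the vector of slopes.\<close>

lemma fenchel_subgradient:
  fixes a :: "int ^ 'n"
  assumes "lattice_convex_on D g" and "\<And>i. discrete_concave_on (I i) (\<psi> i)"
    and "a \<in> D" and "\<And>i. a $ i \<in> I i"
    and "\<And>x. x \<in> D \<Longrightarrow> \<forall>i. x $ i \<in> I i \<Longrightarrow>
      g a - (\<Sum>i\<in>UNIV. \<psi> i (a $ i)) \<le> g x - (\<Sum>i\<in>UNIV. \<psi> i (x $ i))"
  obtains p where "\<And>x. x \<in> D \<Longrightarrow> g a + (int_inner p x - int_inner p a) \<le> g x"
    and "\<And>x. \<forall>i. x $ i \<in> I i \<Longrightarrow>
      (\<Sum>i\<in>UNIV. \<psi> i (x $ i)) \<le> (\<Sum>i\<in>UNIV. \<psi> i (a $ i)) + (int_inner p x - int_inner p a)"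
proof -
  have "\<exists>p. (\<forall>x\<in>D. g a + (\<Sum>i\<in>UNIV. p i * (x $ i - a $ i)) \<le> g x) \<and>
    (\<forall>i\<in>UNIV. \<forall>t\<in>I i. \<psi> i t \<le> \<psi> i (a $ i) + p i * (t - a $ i))"
    by (rule lattice_convex_on_separating_gradient[OF finite assms(1)]) (use assms(2-5) in auto)
  then obtain p where p: "\<And>x. x \<in> D \<Longrightarrow> g a + (\<Sum>i\<in>UNIV. p i * (x $ i - a $ i)) \<le> g x"
    "\<And>i t. t \<in> I i \<Longrightarrow> \<psi> i t \<le> \<psi> i (a $ i) + p i * (t - a $ i)" by blast
  have inner: "int_inner (\<chi> i. p i) x - int_inner (\<chi> i. p i) a = (\<Sum>i\<in>UNIV. p i * (x $ i - a $ i))" for x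
    by (simp add: int_inner_def sum_subtractf right_diff_distrib)
  show thesis
  proof (rule that[of "\<chi> i. p i"], unfold inner)
    fix x :: "int ^ 'n" assume "\<forall>i. x $ i \<in> I i"
    then show "(\<Sum>i\<in>UNIV. \<psi> i (x $ i)) \<le> (\<Sum>i\<in>UNIV. \<psi> i (a $ i)) + (\<Sum>i\<in>UNIV. p i * (x $ i - a $ i))"
      unfolding sum.distrib[symmetric] by (intro sum_mono p(2)) auto
  qed (rule p(1))
qed

section \<open>Integral separation of a domain from a disjoint box\<close>

text \<open>With values in \<open>nat\<close>, the infimum over a nonempty set is attained.\<close>

definition int_dist :: "int set \<Rightarrow> int \<Rightarrow> nat" where
  "int_dist I t = Inf ((\<lambda>s. nat \<bar>t - s\<bar>) ` I)"

lemma int_dist_le: "s \<in> I \<Longrightarrow> int (int_dist I t) \<le> \<bar>t - s\<bar>"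
  unfolding int_dist_def using cInf_lower[of "nat \<bar>t - s\<bar>" "(\<lambda>s. nat \<bar>t - s\<bar>) ` I"] by auto

lemma int_dist_attained:
  assumes "I \<noteq> {}"
  obtains s where "s \<in> I" "int (int_dist I t) = \<bar>t - s\<bar>"
proof -
  have "int_dist I t \<in> (\<lambda>s. nat \<bar>t - s\<bar>) ` I"
    unfolding int_dist_def using assms by (intro Inf_nat_def1) auto
  then show thesis using that by fastforce
qed

text \<open>Let \<open>s\<close> and \<open>s'\<close> be nearest points to \<open>k - 1\<close> and
  \<open>k + 1\<close>. Rounding their midpoint down and up gives points \<open>u\<close> and
  \<open>u'\<close> of \<open>I\<close> whose distances to \<open>k\<close> bound the distance of
  \<open>k\<close> to \<open>I\<close>.\<close>

lemma discrete_concave_on_int_dist: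
  assumes I: "I \<noteq> {}" "\<And>a b. a \<in> I \<Longrightarrow> b \<in> I \<Longrightarrow> {a..b} \<subseteq> I"
  shows "discrete_concave_on UNIV (\<lambda>t. - int (int_dist I t))"
proof -
  have "2 * int (int_dist I k) \<le> int (int_dist I (k - 1)) + int (int_dist I (k + 1))" for k
  proof -
    obtain s where s: "s \<in> I" "int (int_dist I (k - 1)) = \<bar>k - 1 - s\<bar>"
      using int_dist_attained[OF I(1)] by blast
    obtain s' where s': "s' \<in> I" "int (int_dist I (k + 1)) = \<bar>k + 1 - s'\<bar>"
      using int_dist_attained[OF I(1)] by blast
    define u where "u = (s + s') div 2"
    define u' where "u' = s + s' - u"
    have "u \<in> {s..s'} \<or> u \<in> {s'..s}" "u' \<in> {s..s'} \<or> u' \<in> {s'..s}"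
      unfolding u_def u'_def by auto
    then have "u \<in> I" "u' \<in> I" using I(2)[of s s'] I(2)[of s' s] s s' by blast+
    then have "int (int_dist I k) \<le> \<bar>k - u\<bar>" "int (int_dist I k) \<le> \<bar>k - u'\<bar>"
      using int_dist_le by blast+
    moreover have "u' = u \<or> u' = u + 1" unfolding u_def u'_def by presburger
    moreover have "u + u' = s + s'" unfolding u'_def by simp
    \<comment> \<open>No integer lies strictly between \<open>u\<close> and \<open>u'\<close>, so
      their distances to \<open>k\<close> add up to the modulus of \<open>2 * k - (s + s')\<close>,
      and the triangle inequality applies.\<close>
    ultimately show ?thesis using s s' by arith
  qed
  then show ?thesis unfolding discrete_concave_on_def by (simp add: algebra_simps)
qed

text \<open>The same points and weights work. With the zero function, a subgradient on
  \<open>D\<close> describes the geometry of \<open>D\<close> alone, as needed for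
  separation.\<close>

lemma lattice_convex_on_zero:
  assumes "lattice_convex_on D g"
  shows "lattice_convex_on D (\<lambda>_. 0)"
  unfolding lattice_convex_on_def
proof (intro ballI allI impI)
  fix x y t and \<epsilon> :: real
  assume xy: "x \<in> D" "y \<in> D" and t: "t \<in> {0..1::real}" and \<epsilon>: "0 < \<epsilon>"
  have t01: "0 \<le> t" "t \<le> 1" using t by auto
  obtain W l where W: "finite W" "W \<subseteq> D" "\<And>w. w \<in> W \<Longrightarrow> 0 \<le> l w"
    "\<And>w i. w \<in> W \<Longrightarrow> \<bar>(1 - t) * of_int (x $ i) + t * of_int (y $ i) - of_int (w $ i)\<bar> < 1"
    "sum l W = (1::real)"
    "\<And>i. (\<Sum>w\<in>W. l w * of_int (w $ i)) = (1 - t) * of_int (x $ i) + t * of_int (y $ i)"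
    by (rule lattice_convex_onE[OF assms xy t01 \<epsilon>]) (rule that)
  have ineq: "(\<Sum>w\<in>W. l w * of_int 0) \<le> (1 - t) * of_int 0 + t * of_int 0 + \<epsilon>" using \<epsilon> by simp
  show "\<exists>W l. finite W \<and> W \<subseteq> D \<and>
        (\<forall>w\<in>W. 0 \<le> l w \<and> (\<forall>i. \<bar>(1 - t) * of_int (x $ i) + t * of_int (y $ i) - of_int (w $ i)\<bar> < 1)) \<and>
        sum l W = 1 \<and>
        (\<forall>i. (\<Sum>w\<in>W. l w * of_int (w $ i)) = (1 - t) * of_int (x $ i) + t * of_int (y $ i)) \<and>
        (\<Sum>w\<in>W. l w * of_int 0) \<le> (1 - t) * of_int 0 + t * of_int 0 + \<epsilon>"
    by (intro exI[of _ W] exI[of _ l] conjI ballI allI) (rule W ineq | assumption)+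
qed

text \<open>Let \<open>a\<close> be a point of \<open>D\<close> closest to the box. A common
  gradient of zero on \<open>D\<close> and the negated distance attains its maximum over
  \<open>D\<close> at \<open>a\<close> and exceeds that maximum on the box by at least
  \<open>d a\<close>, a positive integer.\<close>

lemma lattice_convex_on_separated_from_box:
  fixes D :: "(int ^ 'n) set"
  assumes g: "lattice_convex_on D g" and "D \<noteq> {}"
    and I: "\<And>i. I i \<noteq> {}" "\<And>i a b. a \<in> I i \<Longrightarrow> b \<in> I i \<Longrightarrow> {a..b} \<subseteq> I i"
    and disj: "\<And>x. x \<in> D \<Longrightarrow> \<not> (\<forall>i. x $ i \<in> I i)"
  obtains p c where "\<And>x. x \<in> D \<Longrightarrow> int_inner p x \<le> c"
    and "\<And>x. \<forall>i. x $ i \<in> I i \<Longrightarrow> c + 1 \<le> int_inner p x"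
proof -
  define d where "d x = (\<Sum>i\<in>UNIV. int_dist (I i) (x $ i))" for x :: "int ^ 'n"
  obtain b where "b \<in> D" using assms(2) by blast
  obtain a where a: "a \<in> D" "\<And>x. x \<in> D \<Longrightarrow> d a \<le> d x"
    using ex_has_least_nat[of "\<lambda>x. x \<in> D" b d] \<open>b \<in> D\<close> by blast
  obtain i where i: "a $ i \<notin> I i" using disj[OF a(1)] by blast
  have "int_dist (I i) (a $ i) \<noteq> 0"
    using int_dist_attained[OF I(1), of i "a $ i"] i by (metis abs_eq_0 eq_iff_diff_eq_0 of_nat_eq_0_iff)
  moreover have "int_dist (I i) (a $ i) \<le> d a"
    unfolding d_def by (rule member_le_sum) auto
  ultimately have pos: "1 \<le> d a" by linarith
  have dsum: "(\<Sum>i\<in>UNIV. - int (int_dist (I i) (x $ i))) = - int (d x)" for x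
    unfolding d_def by (simp add: sum_negf)
  obtain p where p: "\<And>x. x \<in> D \<Longrightarrow> 0 + (int_inner p x - int_inner p a) \<le> 0"
    "\<And>x. \<forall>i. x $ i \<in> (UNIV :: int set) \<Longrightarrow> (\<Sum>i\<in>UNIV. - int (int_dist (I i) (x $ i)))
      \<le> (\<Sum>i\<in>UNIV. - int (int_dist (I i) (a $ i))) + (int_inner p x - int_inner p a)"
  proof (rule fenchel_subgradient[OF lattice_convex_on_zero[OF g] discrete_concave_on_int_dist a(1)])
    show "I i \<noteq> {}" for i by (rule I)
    show "{a..b} \<subseteq> I i" if "a \<in> I i" "b \<in> I i" for i a b using I(2) that .
    show "0 - (\<Sum>i\<in>UNIV. - int (int_dist (I i) (a $ i))) \<le> 0 - (\<Sum>i\<in>UNIV. - int (int_dist (I i) (x $ i)))"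
      if "x \<in> D" for x using a(2)[OF that] unfolding dsum by simp
  qed auto
  show thesis
  proof (rule that[of p "int_inner p a"])
    fix x :: "int ^ 'n" assume x: "\<forall>i. x $ i \<in> I i"
    have "int_dist (I i) (x $ i) = 0" for i
      using int_dist_le[of "x $ i" "I i" "x $ i"] x by simp
    then have "d x = 0" unfolding d_def by simp
    then show "int_inner p a + 1 \<le> int_inner p x"
      using p(2)[of x] pos unfolding dsum by simp
  qed (use p(1) in simp)
qed

section \<open>From extended-valued functions to integer data\<close>

text \<open>By the strict inequality in \<open>int_nbhd\<close>, a lattice point is its own only
  neighbour, and weight one there is feasible.\<close>

lemma local_convex_ext_vec_of_int_le:
  fixes x :: "int ^ 'n"
  shows "local_convex_ext f (vec_of_int x) \<le> f x"
proof -
  have N: "int_nbhd (vec_of_int x) = {x}"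
  proof -
    have "z = x" if "\<And>i. \<bar>real_of_int (x $ i) - of_int (z $ i)\<bar> < 1" for z :: "int ^ 'n"
    proof (rule vec_eq_iff[THEN iffD2], rule allI)
      show "z $ i = x $ i" for i using that[of i] by linarith
    qed
    then show ?thesis unfolding int_nbhd_def vec_of_int_def by auto
  qed
  show ?thesis
    unfolding local_convex_ext_def N by (rule Inf_lower) (auto intro!: exI[of _ "\<lambda>_. 1"])
qed

text \<open>The slack makes the bound on the infimum strict, so some feasible family of weights
  stays below it. Its sum is then not infinite, which forces the support into
  \<open>D\<close>.\<close>

lemma integrally_convex_imp_lattice_convex_on:
  fixes f :: "int ^ 'n \<Rightarrow> ereal"
  assumes f: "\<And>x. f x = (if x \<in> D then ereal (of_int (g x)) else \<infinity>)"
    and conv: "ext_convex (local_convex_ext f)"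
  shows "lattice_convex_on D g"
  unfolding lattice_convex_on_def
proof (intro ballI allI impI)
  fix x y t and \<epsilon> :: real
  assume xy: "x \<in> D" "y \<in> D" and t: "t \<in> {0..1::real}" and \<epsilon>: "0 < \<epsilon>"
  define c where "c = (1 - t) * of_int (g x) + t * of_int (g y)"
  define z where "z = (1 - t) *\<^sub>R vec_of_int x + t *\<^sub>R vec_of_int y"
  have zi: "z $ i = (1 - t) * of_int (x $ i) + t * of_int (y $ i)" for i
    unfolding z_def vec_of_int_def by simp
  have "local_convex_ext f z \<le> ereal (1 - t) * local_convex_ext f (vec_of_int x)
      + ereal t * local_convex_ext f (vec_of_int y)"
    using conv t unfolding ext_convex_def z_def by blast
  also have "\<dots> \<le> ereal (1 - t) * f x + ereal t * f y"
    using t by (intro add_mono ereal_mult_left_mono local_convex_ext_vec_of_int_le) auto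
  also have "\<dots> < ereal (c + \<epsilon>)" using xy \<epsilon> by (simp add: f c_def)
  finally obtain l where l: "(\<Sum>w\<in>int_nbhd z. ereal (l w) * f w) < ereal (c + \<epsilon>)"
    "(\<Sum>w\<in>int_nbhd z. l w *\<^sub>R vec_of_int w) = z"
    "(\<Sum>w\<in>int_nbhd z. l w) = 1" "\<And>w. w \<in> int_nbhd z \<Longrightarrow> 0 \<le> l w"
    unfolding local_convex_ext_def Inf_less_iff by blast
  \<comment> \<open>A sum over an infinite set is zero by convention, but the weights sum to
    one.\<close>
  have fin: "finite (int_nbhd z)" using l(3) by (metis sum.infinite zero_neq_one)
  have noinf: "ereal (l w) * f w \<noteq> \<infinity>" if "w \<in> int_nbhd z" for w
    using l(1) that fin sum_Pinfty[of "\<lambda>w. ereal (l w) * f w" "int_nbhd z"] by auto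
  \<comment> \<open>Neighbours outside \<open>D\<close> may occur with weight zero, where the
    product with \<infinity> vanishes; passing to the support removes them.\<close>
  define W where "W = {w \<in> int_nbhd z. l w \<noteq> 0}"
  have WN: "W \<subseteq> int_nbhd z" unfolding W_def by blast
  have finW: "finite W" using fin WN by (rule rev_finite_subset)
  have WD: "W \<subseteq> D"
  proof
    fix w assume w: "w \<in> W"
    then have "0 < l w" using l(4)[of w] unfolding W_def by auto
    then show "w \<in> D" using noinf[of w] w by (auto simp: f W_def split: if_splits)
  qed
  have "(\<Sum>w\<in>int_nbhd z. ereal (l w) * f w) = (\<Sum>w\<in>W. ereal (l w) * f w)"
    using fin by (intro sum.mono_neutral_right) (auto simp: W_def zero_ereal_def[symmetric])
  also have "\<dots> = (\<Sum>w\<in>W. ereal (l w * of_int (g w)))"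
    using WD by (intro sum.cong) (auto simp: f)
  also have "\<dots> = ereal (\<Sum>w\<in>W. l w * of_int (g w))" by simp
  finally have ineq: "(\<Sum>w\<in>W. l w * of_int (g w)) \<le> c + \<epsilon>" using l(1) by simp
  have one: "sum l W = 1"
    using l(3) fin by (subst sum.mono_neutral_left[of "int_nbhd z"]) (auto simp: W_def)
  have bary: "(\<Sum>w\<in>W. l w * of_int (w $ i)) = (1 - t) * of_int (x $ i) + t * of_int (y $ i)" for i
  proof -
    have "(\<Sum>w\<in>W. l w * of_int (w $ i)) = (\<Sum>w\<in>int_nbhd z. l w * of_int (w $ i))"
      using fin by (intro sum.mono_neutral_left) (auto simp: W_def)
    also have "\<dots> = (\<Sum>w\<in>int_nbhd z. l w *\<^sub>R vec_of_int w) $ i"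
      by (simp add: vec_of_int_def)
    finally show ?thesis unfolding l(2) zi .
  qed
  have near: "\<bar>(1 - t) * of_int (x $ i) + t * of_int (y $ i) - of_int (w $ i)\<bar> < 1" if "w \<in> W" for w i
    using that unfolding W_def int_nbhd_def zi[symmetric] by blast
  have nonneg: "0 \<le> l w" if "w \<in> W" for w using l(4) that WN by blast
  show "\<exists>W l. finite W \<and> W \<subseteq> D \<and>
        (\<forall>w\<in>W. 0 \<le> l w \<and> (\<forall>i. \<bar>(1 - t) * of_int (x $ i) + t * of_int (y $ i) - of_int (w $ i)\<bar> < 1)) \<and>
        sum l W = 1 \<and>
        (\<forall>i. (\<Sum>w\<in>W. l w * of_int (w $ i)) = (1 - t) * of_int (x $ i) + t * of_int (y $ i)) \<and>
        (\<Sum>w\<in>W. l w * of_int (g w)) \<le> (1 - t) * of_int (g x) + t * of_int (g y) + \<epsilon>"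
    by (intro exI[of _ W] exI[of _ l] conjI ballI allI)
      (rule finW WD nonneg near one bary ineq[unfolded c_def] | assumption)+
qed

text \<open>In \<open>ereal\<close> the sum of \<infinity> and -\<infinity> is \<infinity>, so a
  summand -\<infinity> prevails only in the absence of \<infinity>.\<close>

lemma sum_ereal_eq_MInfty:
  fixes h :: "'a \<Rightarrow> ereal"
  assumes "finite A" "\<And>i. i \<in> A \<Longrightarrow> h i \<noteq> \<infinity>" "i \<in> A" "h i = - \<infinity>"
  shows "sum h A = - \<infinity>"
proof -
  have "sum h (A - {i}) \<noteq> \<infinity>" using assms sum_Pinfty[of h "A - {i}"] by auto
  then show ?thesis using assms by (subst sum.remove[of _ i]) auto
qed

lemma int_separable_concaveE:
  fixes \<Psi> :: "int ^ 'n \<Rightarrow> ereal"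
  assumes "int_separable_concave \<Psi>"
  obtains I \<phi> where "\<And>i. discrete_concave_on (I i) (\<phi> i)"
    and "\<And>x. \<Psi> x = (if \<forall>i. x $ i \<in> I i then ereal (of_int (\<Sum>i\<in>UNIV. \<phi> i (x $ i))) else - \<infinity>)"
proof -
  obtain \<psi> where \<psi>: "\<And>i. int_discrete_concave (\<psi> i)" "\<And>x. \<Psi> x = (\<Sum>i\<in>UNIV. \<psi> i (x $ i))"
    using assms unfolding int_separable_concave_def by blast
  define I where "I i = eff_dom (\<psi> i)" for i
  \<comment> \<open>On \<open>I i\<close> the value is already an integer, and the floor merely
    changes its type.\<close>
  define \<phi> where "\<phi> i k = \<lfloor>real_of_ereal (\<psi> i k)\<rfloor>" for i k
  have vals: "\<psi> i k \<in> ext_ints \<union> {- \<infinity>}" for i k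
    using \<psi>(1)[of i] unfolding int_discrete_concave_def by blast
  have \<phi>: "\<psi> i k = (if k \<in> I i then ereal (of_int (\<phi> i k)) else - \<infinity>)" for i k
    using vals[of i k] unfolding I_def \<phi>_def eff_dom_def ext_ints_def by auto
  have conc: "discrete_concave_on (I i) (\<phi> i)" for i
    unfolding discrete_concave_on_def
  proof (intro conjI allI impI)
    show "\<forall>a\<in>I i. \<forall>b\<in>I i. {a..b} \<subseteq> I i"
      using \<psi>(1)[of i] unfolding int_discrete_concave_def I_def by blast
    fix k assume k: "k - 1 \<in> I i" "k + 1 \<in> I i"
    have "{k - 1..k + 1} \<subseteq> I i"
      using \<psi>(1)[of i] k unfolding int_discrete_concave_def I_def by blast
    then have kI: "k \<in> I i" by auto
    have "\<psi> i (k - 1) + \<psi> i (k + 1) \<le> 2 * \<psi> i k"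
      using \<psi>(1)[of i] unfolding int_discrete_concave_def by blast
    then have "ereal (of_int (\<phi> i (k - 1) + \<phi> i (k + 1))) \<le> 2 * ereal (of_int (\<phi> i k))"
      using k kI by (simp add: \<phi>)
    also have "\<dots> = ereal (of_int (2 * \<phi> i k))" by (simp add: numeral_eq_ereal)
    finally show "\<phi> i (k - 1) + \<phi> i (k + 1) \<le> 2 * \<phi> i k"
      unfolding ereal_less_eq of_int_le_iff .
  qed
  have "\<Psi> x = (if \<forall>i. x $ i \<in> I i then ereal (of_int (\<Sum>i\<in>UNIV. \<phi> i (x $ i))) else - \<infinity>)" for x
  proof (cases "\<forall>i. x $ i \<in> I i")
    case True
    then show ?thesis unfolding \<psi>(2) by (simp add: \<phi>)
  next
    case False
    then obtain i where i: "x $ i \<notin> I i" by blast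
    have "(\<Sum>i\<in>UNIV. \<psi> i (x $ i)) = - \<infinity>"
      by (rule sum_ereal_eq_MInfty[of _ _ i]) (use i in \<open>auto simp: \<phi>\<close>)
    then show ?thesis using False \<psi>(2) by simp
  qed
  then show thesis using that conc by blast
qed

section \<open>Weak duality and unbounded dual values\<close>

text \<open>Testing both conjugates at \<open>x\<close> and subtracting cancels the inner product.
  If \<open>f x\<close> or \<open>\<Psi> x\<close> is infinite, the right-hand side is
  \<infinity>.\<close>

lemma weak_duality:
  assumes f: "f x \<noteq> - \<infinity>" and \<Psi>: "\<Psi> x \<noteq> \<infinity>"
  shows "concave_conj \<Psi> p - convex_conj f p \<le> f x - \<Psi> x"
proof (cases "f x = \<infinity> \<or> \<Psi> x = - \<infinity>")
  case True
  then show ?thesis using f \<Psi> by (cases "f x"; cases "\<Psi> x") auto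
next
  case False
  then obtain u v where uv: "f x = ereal u" "\<Psi> x = ereal v" using f \<Psi> by (cases "f x"; cases "\<Psi> x") auto
  have "concave_conj \<Psi> p \<le> ereal (of_int (int_inner p x)) - \<Psi> x"
    unfolding concave_conj_def by (rule INF_lower) simp
  moreover have "ereal (of_int (int_inner p x)) - f x \<le> convex_conj f p"
    unfolding convex_conj_def by (rule SUP_upper) simp
  ultimately have "concave_conj \<Psi> p - convex_conj f p
      \<le> (ereal (of_int (int_inner p x)) - \<Psi> x) - (ereal (of_int (int_inner p x)) - f x)"
    by (rule ereal_minus_mono)
  then show ?thesis unfolding uv by simp
qed

lemma int_inner_add_scaled: "int_inner (p + c *s q) x = int_inner p x + c * int_inner q x"
  by (simp add: int_inner_def sum.distrib sum_distrib_left algebra_simps)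

text \<open>Moving from \<open>p\<close> by \<open>n\<close> times \<open>q\<close> raises the
  concave conjugate by at least \<open>n * (c + 1)\<close> and the convex one by at most
  \<open>n * c\<close>, a gain of at least \<open>n\<close>.\<close>

lemma dual_unbounded:
  fixes f \<Psi> :: "int ^ 'n \<Rightarrow> ereal"
  assumes f: "eff_dom f \<noteq> {}" "\<And>x. f x \<noteq> - \<infinity>" and \<Psi>: "eff_dom \<Psi> \<noteq> {}" "\<And>x. \<Psi> x \<noteq> \<infinity>"
    and sep: "\<And>x. x \<in> eff_dom f \<Longrightarrow> int_inner q x \<le> c"
      "\<And>x. x \<in> eff_dom \<Psi> \<Longrightarrow> c + 1 \<le> int_inner q x"
    and proper: "concave_conj \<Psi> p - convex_conj f p \<noteq> - \<infinity>"
  shows "(SUP p. concave_conj \<Psi> p - convex_conj f p) = \<infinity>"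
proof -
  have cv: "ereal (of_int (int_inner p x)) - f x \<le> convex_conj f p" for p x
    unfolding convex_conj_def by (rule SUP_upper) simp
  have cc: "concave_conj \<Psi> p \<le> ereal (of_int (int_inner p x)) - \<Psi> x" for p x
    unfolding concave_conj_def by (rule INF_lower) simp
  \<comment> \<open>Nonempty domains exclude -\<infinity> for the convex and \<infinity> for the
    concave conjugate. Any other infinite value would make the dual value at \<open>p\<close> equal
    to -\<infinity>.\<close>
  obtain x where "x \<in> eff_dom f" using f by blast
  then have "convex_conj f p \<noteq> - \<infinity>"
    using cv[of p x] unfolding eff_dom_def by (cases "f x") auto
  moreover obtain y where "y \<in> eff_dom \<Psi>" using \<Psi> by blast
  then have "concave_conj \<Psi> p \<noteq> \<infinity>"
    using cc[of p y] unfolding eff_dom_def by (cases "\<Psi> y") auto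
  ultimately obtain u w where uw: "concave_conj \<Psi> p = ereal u" "convex_conj f p = ereal w"
    using proper by (cases "concave_conj \<Psi> p"; cases "convex_conj f p") auto
  have step: "ereal (u - w + of_nat n) \<le> concave_conj \<Psi> (p + int n *s q) - convex_conj f (p + int n *s q)" for n
  proof -
    have 1: "ereal (u + of_nat n * of_int (c + 1)) \<le> concave_conj \<Psi> (p + int n *s q)"
      unfolding concave_conj_def
    proof (rule INF_greatest)
      fix x
      show "ereal (u + of_nat n * of_int (c + 1)) \<le> ereal (of_int (int_inner (p + int n *s q) x)) - \<Psi> x"
      proof (cases "\<Psi> x")
        case (real r)
        then have "x \<in> eff_dom \<Psi>" unfolding eff_dom_def by simp
        then have "real_of_int (c + 1) \<le> of_int (int_inner q x)" using sep(2) of_int_le_iff by blast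
        then have "of_nat n * real_of_int (c + 1) \<le> of_nat n * of_int (int_inner q x)"
          by (rule mult_left_mono) simp
        then show ?thesis using cc[of p x] real unfolding uw int_inner_add_scaled by simp
      qed (use \<Psi> in auto)
    qed
    have 2: "convex_conj f (p + int n *s q) \<le> ereal (w + of_nat n * of_int c)"
      unfolding convex_conj_def
    proof (rule SUP_least)
      fix x
      show "ereal (of_int (int_inner (p + int n *s q) x)) - f x \<le> ereal (w + of_nat n * of_int c)"
      proof (cases "f x")
        case (real r)
        then have "x \<in> eff_dom f" unfolding eff_dom_def by simp
        then have "real_of_int (int_inner q x) \<le> of_int c" using sep(1) of_int_le_iff by blast
        then have "of_nat n * real_of_int (int_inner q x) \<le> of_nat n * of_int c"
          by (rule mult_left_mono) simp
        then show ?thesis using cv[of p x] real unfolding uw int_inner_add_scaled by simp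
      qed (use f in auto)
    qed
    have "ereal (u - w + of_nat n) = ereal (u + of_nat n * of_int (c + 1)) - ereal (w + of_nat n * of_int c)"
      by (simp add: algebra_simps)
    also have "\<dots> \<le> concave_conj \<Psi> (p + int n *s q) - convex_conj f (p + int n *s q)"
      using 1 2 by (rule ereal_minus_mono)
    finally show ?thesis .
  qed
  show ?thesis
  proof (rule ereal_top)
    fix B :: real
    obtain n where "B - (u - w) \<le> of_nat n" using real_arch_simple by blast
    then have "ereal B \<le> ereal (u - w + of_nat n)" by simp
    also note step
    also have "concave_conj \<Psi> (p + int n *s q) - convex_conj f (p + int n *s q)
        \<le> (SUP p. concave_conj \<Psi> p - convex_conj f p)" by (rule SUP_upper) simp
    finally show "ereal B \<le> (SUP p. concave_conj \<Psi> p - convex_conj f p)" .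
  qed
qed

section \<open>Attainment and strong duality\<close>

lemma int_fun_has_least:
  fixes h :: "'a \<Rightarrow> int" and b :: real
  assumes "A \<noteq> {}" "\<And>x. x \<in> A \<Longrightarrow> b \<le> of_int (h x)"
  obtains a where "a \<in> A" "\<And>x. x \<in> A \<Longrightarrow> h a \<le> h x"
proof -
  obtain y where "y \<in> A" using assms by blast
  then obtain a where a: "a \<in> A" "\<And>x. x \<in> A \<Longrightarrow> nat (h a - \<lfloor>b\<rfloor>) \<le> nat (h x - \<lfloor>b\<rfloor>)"
    using ex_has_least_nat[of "\<lambda>x. x \<in> A" y "\<lambda>x. nat (h x - \<lfloor>b\<rfloor>)"] by blast
  have "\<lfloor>b\<rfloor> \<le> h x" if "x \<in> A" for x using assms(2)[OF that] by linarith
  then have "h a \<le> h x" if "x \<in> A" for x using a that by fastforce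
  then show thesis using that a by blast
qed

theorem theorem1p1:
  fixes f \<Psi> :: "int ^ 'n \<Rightarrow> ereal"
  assumes "\<forall>x. f x \<in> ext_ints \<union> {\<infinity>}"
    and "eff_dom f \<noteq> {}"
    and "integrally_convex f"
    and "\<forall>x. \<Psi> x \<in> ext_ints \<union> {- \<infinity>}"
    and "eff_dom \<Psi> \<noteq> {}"
    and "int_separable_concave \<Psi>"
    and "\<bar>INF x. f x - \<Psi> x\<bar> \<noteq> \<infinity> \<or> \<bar>SUP p. concave_conj \<Psi> p - convex_conj f p\<bar> \<noteq> \<infinity>"
  shows "(INF x. f x - \<Psi> x) = (SUP p. concave_conj \<Psi> p - convex_conj f p)"
proof -
  define D where "D = eff_dom f"
  define g where "g x = \<lfloor>real_of_ereal (f x)\<rfloor>" for x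
  have f: "f x = (if x \<in> D then ereal (of_int (g x)) else \<infinity>)" for x
  proof -
    have "f x \<in> ext_ints \<union> {\<infinity>}" using assms(1) by blast
    then show ?thesis unfolding D_def g_def eff_dom_def ext_ints_def by auto
  qed
  have conv: "lattice_convex_on D g"
    using integrally_convex_imp_lattice_convex_on[OF f] assms(3) unfolding integrally_convex_def by blast
  obtain I \<phi> where \<phi>: "\<And>i. discrete_concave_on (I i) (\<phi> i)"
    and \<Psi>: "\<And>x. \<Psi> x = (if \<forall>i. x $ i \<in> I i then ereal (of_int (\<Sum>i\<in>UNIV. \<phi> i (x $ i))) else - \<infinity>)"
    using int_separable_concaveE[OF assms(6)] by blast
  have dom\<Psi>: "x \<in> eff_dom \<Psi> \<longleftrightarrow> (\<forall>i. x $ i \<in> I i)" for x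
    unfolding eff_dom_def by (simp add: \<Psi>)
  have f_ninf: "f x \<noteq> - \<infinity>" for x by (simp add: f)
  have \<Psi>_ninf: "\<Psi> x \<noteq> \<infinity>" for x by (simp add: \<Psi>)
  have weak: "(SUP p. concave_conj \<Psi> p - convex_conj f p) \<le> (INF x. f x - \<Psi> x)"
    by (intro SUP_least INF_greatest weak_duality f_ninf \<Psi>_ninf)
  \<comment> \<open>With disjoint domains the infimum is \<infinity>, so the supremum is assumed
    finite and some dual value exceeds -\<infinity>. Starting there, a separating vector drives the
    dual values to \<infinity>, a contradiction.\<close>
  have "D \<inter> eff_dom \<Psi> \<noteq> {}"
  proof
    assume empty: "D \<inter> eff_dom \<Psi> = {}"
    have "f x - \<Psi> x = \<infinity>" for x
      using empty dom\<Psi>[of x] f[of x] \<Psi>[of x] by (auto split: if_splits)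
    then have "(INF x. f x - \<Psi> x) = \<infinity>" by simp
    then have fin: "\<bar>SUP p. concave_conj \<Psi> p - convex_conj f p\<bar> \<noteq> \<infinity>" using assms(7) by simp
    then have "- \<infinity> < (SUP p. concave_conj \<Psi> p - convex_conj f p)" by auto
    then obtain p where p: "- \<infinity> < concave_conj \<Psi> p - convex_conj f p"
      unfolding less_SUP_iff by blast
    have "\<And>i. I i \<noteq> {}" using assms(5) dom\<Psi> by auto
    moreover have "\<And>i a b. a \<in> I i \<Longrightarrow> b \<in> I i \<Longrightarrow> {a..b} \<subseteq> I i"
      using \<phi> unfolding discrete_concave_on_def by blast
    moreover have "\<And>x. x \<in> D \<Longrightarrow> \<not> (\<forall>i. x $ i \<in> I i)" using empty dom\<Psi> by blast
    ultimately obtain q c where q: "\<And>x. x \<in> D \<Longrightarrow> int_inner q x \<le> c"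
      "\<And>x. \<forall>i. x $ i \<in> I i \<Longrightarrow> c + 1 \<le> int_inner q x"
      using lattice_convex_on_separated_from_box[OF conv, of I] assms(2) unfolding D_def by metis
    have "(SUP p. concave_conj \<Psi> p - convex_conj f p) = \<infinity>"
      by (rule dual_unbounded[where q = q and c = c and p = p])
        (use assms(2,5) f_ninf \<Psi>_ninf q p dom\<Psi> in \<open>auto simp: D_def\<close>)
    then show False using fin by simp
  qed
  then obtain y where y: "y \<in> D" "\<forall>i. y $ i \<in> I i" using dom\<Psi> by blast
  define h where "h x = g x - (\<Sum>i\<in>UNIV. \<phi> i (x $ i))" for x
  define A where "A = {x \<in> D. \<forall>i. x $ i \<in> I i}"
  have hA: "f x - \<Psi> x = ereal (of_int (h x))" if "x \<in> A" for x
    using that by (simp add: A_def f \<Psi> h_def)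
  have yA: "y \<in> A" using y by (simp add: A_def)
  have INF_le: "(INF x. f x - \<Psi> x) \<le> ereal (of_int (h x))" if "x \<in> A" for x
    using INF_lower[of x UNIV "\<lambda>x. f x - \<Psi> x"] hA[OF that] by simp
  \<comment> \<open>If only the supremum is known to be finite, weak duality bounds the infimum from
    below.\<close>
  have "(INF x. f x - \<Psi> x) \<noteq> - \<infinity>" using assms(7) weak by auto
  then obtain b where b: "(INF x. f x - \<Psi> x) = ereal b"
    using INF_le[OF yA] by (cases "INF x. f x - \<Psi> x") auto
  obtain a where a: "a \<in> A" "\<And>x. x \<in> A \<Longrightarrow> h a \<le> h x"
    using int_fun_has_least[of A b h] INF_le yA unfolding b by auto
  obtain p where p: "\<And>x. x \<in> D \<Longrightarrow> g a + (int_inner p x - int_inner p a) \<le> g x"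
    "\<And>x. \<forall>i. x $ i \<in> I i \<Longrightarrow>
      (\<Sum>i\<in>UNIV. \<phi> i (x $ i)) \<le> (\<Sum>i\<in>UNIV. \<phi> i (a $ i)) + (int_inner p x - int_inner p a)"
    by (rule fenchel_subgradient[OF conv \<phi>, of a]) (use a in \<open>auto simp: A_def h_def\<close>)
  \<comment> \<open>By the two gradient inequalities, both conjugates at \<open>p\<close> have their
    extreme value at \<open>a\<close>. The inner products cancel, so the dual value at
    \<open>p\<close> is at least the primal value \<open>h a\<close>.\<close>
  have 1: "ereal (of_int (int_inner p a - (\<Sum>i\<in>UNIV. \<phi> i (a $ i)))) \<le> concave_conj \<Psi> p"
    unfolding concave_conj_def
  proof (rule INF_greatest)
    fix x
    show "ereal (of_int (int_inner p a - (\<Sum>i\<in>UNIV. \<phi> i (a $ i)))) \<le> ereal (of_int (int_inner p x)) - \<Psi> x"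
    proof (cases "\<forall>i. x $ i \<in> I i")
      case True
      have "int_inner p a - (\<Sum>i\<in>UNIV. \<phi> i (a $ i)) \<le> int_inner p x - (\<Sum>i\<in>UNIV. \<phi> i (x $ i))"
        using p(2)[OF True] by simp
      then have "ereal (of_int (int_inner p a - (\<Sum>i\<in>UNIV. \<phi> i (a $ i))))
          \<le> ereal (of_int (int_inner p x - (\<Sum>i\<in>UNIV. \<phi> i (x $ i))))"
        unfolding ereal_less_eq of_int_le_iff .
      then show ?thesis using True by (simp add: \<Psi>)
    qed (auto simp: \<Psi>)
  qed
  have 2: "convex_conj f p \<le> ereal (of_int (int_inner p a - g a))"
    unfolding convex_conj_def
  proof (rule SUP_least)
    fix x
    show "ereal (of_int (int_inner p x)) - f x \<le> ereal (of_int (int_inner p a - g a))"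
    proof (cases "x \<in> D")
      case True
      have "int_inner p x - g x \<le> int_inner p a - g a"
        using p(1)[OF True] by simp
      then have "ereal (of_int (int_inner p x - g x)) \<le> ereal (of_int (int_inner p a - g a))"
        unfolding ereal_less_eq of_int_le_iff .
      then show ?thesis using True by (simp add: f)
    qed (auto simp: f)
  qed
  have "(INF x. f x - \<Psi> x) \<le> ereal (of_int (h a))" by (rule INF_le[OF a(1)])
  also have "\<dots> = ereal (of_int (int_inner p a - (\<Sum>i\<in>UNIV. \<phi> i (a $ i))))
      - ereal (of_int (int_inner p a - g a))" by (simp add: h_def)
  also have "\<dots> \<le> concave_conj \<Psi> p - convex_conj f p" using 1 2 by (rule ereal_minus_mono)
  also have "\<dots> \<le> (SUP p. concave_conj \<Psi> p - convex_conj f p)" by (rule SUP_upper) simp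
  finally show ?thesis using weak by (rule antisym)
qed

end
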